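(* Let $m,n\geq 1$ be integers and let $G_{m\times n}=P_m\square P_n$ be the grid graph with vertex set $[m]\times[n]$, where $(i,j)$ and $(i',j')$ are adjacent if and only if $|i-i'|+|j-j'|=1$. Let $d=\gcd(m+1,n+1)$ and let $v=(a,b)$ be a vertex of $G_{m\times n}$. Then, in the Undirected Edge Geography game, $(G_{m\times n},v)$ is a P-position if and only if $d\nmid a$ and $d\nmid b$.
   Context: Undirected Edge Geography (UEG) is a two-player game on a rooted graph. A position is a pair $(H,v)$ with $H$ a graph and $v$ a vertex (the root). A move consists of choosing an edge of $H$ incident to $v$, deleting it from $H$, and making its other endpoint the new root. Players alternate moves; the first player unable to move loses. A position is an N-position if the player to move has a winning strategy, and a P-position otherwise (the player who just moved wins). *)

theory Defs
  imports Main
begin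

text \<open>
  Undirected simple graphs, given by a vertex set and a set of two-element edges
  \<open>{u, v}\<close>.
\<close>

record 'a ugraph =
  verts :: "'a set"
  edges :: "'a set set"

definition delete_edge :: "'a ugraph \<Rightarrow> 'a set \<Rightarrow> 'a ugraph" where
  "delete_edge H e = H\<lparr>edges := edges H - {e}\<rparr>"

definition grid_graph :: "nat \<Rightarrow> nat \<Rightarrow> (nat \<times> nat) ugraph" where
  "grid_graph m n =
     \<lparr>verts = {1..m} \<times> {1..n},
      edges = {{(i, j), (i', j')} | i j i' j'.
        (i, j) \<in> {1..m} \<times> {1..n} \<and> (i', j') \<in> {1..m} \<times> {1..n} \<and>
        \<bar>int i - int i'\<bar> + \<bar>int j - int j'\<bar> = 1}\<rparr>"

type_synonym 'a position = "'a ugraph \<times> 'a"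

inductive ueg_move :: "'a position \<Rightarrow> 'a position \<Rightarrow> bool" where
  "{v, w} \<in> edges H \<Longrightarrow> ueg_move (H, v) (delete_edge H {v, w}, w)"

text \<open>
  A complete play is a maximal sequence of moves; since every move deletes an edge, all
  plays on a finite graph are finite.  The player to move at its first position moves at
  the positions of even index, so the play is lost by that player if the last index is
  even and won by that player if the last index is odd, i.e. if the length is even.
\<close>

definition complete_play :: "'a position \<Rightarrow> 'a position list \<Rightarrow> bool" where
  "complete_play p ps \<longleftrightarrow>
     ps \<noteq> [] \<and> hd ps = p \<and> successively ueg_move ps \<and> (\<nexists>q. ueg_move (last ps) q)"

text \<open>
  Strategies are positional: they assign to each position the position moved to.
  They must make a legal move whenever there is one; this excludes strategies
  that no complete play could follow and that would be winning vacuously.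
\<close>

definition strategy :: "('a position \<Rightarrow> 'a position) \<Rightarrow> bool" where
  "strategy s \<longleftrightarrow> (\<forall>p. (\<exists>q. ueg_move p q) \<longrightarrow> ueg_move p (s p))"

definition first_player_follows ::
    "('a position \<Rightarrow> 'a position) \<Rightarrow> 'a position list \<Rightarrow> bool" where
  "first_player_follows s ps \<longleftrightarrow>
     (\<forall>i. even i \<and> Suc i < length ps \<longrightarrow> ps ! Suc i = s (ps ! i))"

definition winning_strategy ::
    "'a position \<Rightarrow> ('a position \<Rightarrow> 'a position) \<Rightarrow> bool" where
  "winning_strategy p s \<longleftrightarrow> strategy s \<and>
     (\<forall>ps. complete_play p ps \<and> first_player_follows s ps \<longrightarrow> even (length ps))"

definition N_position :: "'a position \<Rightarrow> bool" where
  "N_position p \<longleftrightarrow> (\<exists>s. winning_strategy p s)"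

definition P_position :: "'a position \<Rightarrow> bool" where
  "P_position p \<longleftrightarrow> \<not> N_position p"

end

theory Submission
  imports Defs
begin

text \<open>
  If \<open>S\<close> is an independent set such that every vertex outside \<open>S\<close> has an even number of
  neighbours in \<open>S\<close>, then every root in \<open>S\<close> is a P-position: each move leaves \<open>S\<close>, and by
  parity the opponent can return to \<open>S\<close>, which restores the parity condition.
  For \<open>d \<nmid> a\<close>, \<open>d \<nmid> b\<close> such a set containing \<open>(a, b)\<close> is the support of
  \<open>G (i + j) + G (i - j)\<close> over the two-element field, where \<open>G\<close> is the indicator function of
  the integers congruent to \<open>a + b\<close> or \<open>- (a + b)\<close> modulo \<open>2 d\<close>.

  Conversely, let \<open>d dvd a\<close> or \<open>d dvd b\<close>.  A vector in the kernel of the adjacency matrix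
  over the two-element field extends by reflection to a solution of the discrete wave
  equation on the integer plane that vanishes on all lines \<open>i = k (m + 1)\<close> and
  \<open>j = l (n + 1)\<close>; such a solution is symmetric under transposition about each crossing
  point of these lines, and one of these symmetries maps \<open>(a, b)\<close> to a line where the
  solution vanishes.  By duality the unit vector at \<open>(a, b)\<close> is in the image of the adjacency
  matrix: there is a set \<open>T\<close> such that \<open>(a, b)\<close> is the only vertex with an odd number of
  neighbours in \<open>T\<close>.  The first player moves to \<open>T\<close> and is then in the situation above.
\<close>

section \<open>Even kernels and the game\<close>

text \<open>Finiteness matters because \<open>card\<close> of an infinite set is 0, hence even. The
  case \<open>x = y\<close> of independence excludes loops at vertices of \<open>S\<close>.\<close>

definition even_kernel :: "'a set \<Rightarrow> 'a ugraph \<Rightarrow> bool" where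
  "even_kernel S H \<longleftrightarrow> finite S \<and> (\<forall>x\<in>S. \<forall>y\<in>S. {x, y} \<notin> edges H) \<and>
     (\<forall>w. w \<notin> S \<longrightarrow> even (card {u\<in>S. {w, u} \<in> edges H}))"

lemma ueg_move_iff:
  "ueg_move (H, v) q \<longleftrightarrow> (\<exists>w. {v, w} \<in> edges H \<and> q = (delete_edge H {v, w}, w))"
  by (auto simp: ueg_move.simps)

lemma edges_delete_edge [simp]: "edges (delete_edge H e) = edges H - {e}"
  by (simp add: delete_edge_def)

text \<open>Deleting an edge from \<open>v\<close> to \<open>u \<in> T\<close> affects the number of
  neighbours in \<open>T\<close>, among vertices outside \<open>T\<close>, only at \<open>v\<close>,
  where it drops by one. This repairs the single odd vertex.\<close>

lemma ex_move_to_even_kernel: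
  assumes "finite T" "\<forall>x\<in>T. \<forall>y\<in>T. {x, y} \<notin> edges H" "v \<notin> T"
    and odd: "odd (card {u\<in>T. {v, u} \<in> edges H})"
    and even: "\<And>w. w \<notin> T \<Longrightarrow> w \<noteq> v \<Longrightarrow> even (card {u\<in>T. {w, u} \<in> edges H})"
  shows "\<exists>u\<in>T. ueg_move (H, v) (delete_edge H {v, u}, u) \<and> even_kernel T (delete_edge H {v, u})"
proof -
  from odd have "{u\<in>T. {v, u} \<in> edges H} \<noteq> {}" by (metis card.empty even_zero)
  then obtain u where u: "u \<in> T" "{v, u} \<in> edges H" by blast
  have "even (card {x\<in>T. {w, x} \<in> edges H - {{v, u}}})" if "w \<notin> T" for w
  proof (cases "w = v")
    case True
    have "{x\<in>T. {w, x} \<in> edges H - {{v, u}}} = {x\<in>T. {v, x} \<in> edges H} - {u}"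
      using True u by (auto simp: doubleton_eq_iff)
    moreover have "card ({x\<in>T. {v, x} \<in> edges H} - {u}) = card {x\<in>T. {v, x} \<in> edges H} - 1"
      using u by (intro card_Diff_singleton) auto
    ultimately show ?thesis using odd by simp
  next
    case False
    then have "{x\<in>T. {w, x} \<in> edges H - {{v, u}}} = {x\<in>T. {w, x} \<in> edges H}"
      using that u by (auto simp: doubleton_eq_iff)
    then show ?thesis using even[OF that False] by simp
  qed
  then have "even_kernel T (delete_edge H {v, u})"
    using assms(1,2) by (simp add: even_kernel_def)
  then show ?thesis using u by (auto simp: ueg_move_iff)
qed

text \<open>Independence forces the move to leave \<open>S\<close>; the deleted edge makes the new
  root \<open>w\<close> the only odd vertex outside \<open>S\<close>, so a move back to
  \<open>S\<close> repairs it. The strict inclusion of edge sets drives the induction over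
  plays.\<close>

lemma even_kernel_reply:
  assumes K: "even_kernel S H" "v \<in> S" and mv: "ueg_move (H, v) q"
  shows "\<exists>H' u. ueg_move q (H', u) \<and> u \<in> S \<and> even_kernel S H' \<and> edges H' \<subset> edges H"
proof -
  from mv obtain w where w: "{v, w} \<in> edges H" "q = (delete_edge H {v, w}, w)"
    by (auto simp: ueg_move_iff)
  from K have S: "finite S" "\<forall>x\<in>S. \<forall>y\<in>S. {x, y} \<notin> edges H"
    and ev: "\<And>w. w \<notin> S \<Longrightarrow> even (card {u\<in>S. {w, u} \<in> edges H})"
    by (auto simp: even_kernel_def)
  have "w \<notin> S" using S(2) K(2) w(1) by blast
  have "{u\<in>S. {w, u} \<in> edges H - {{v, w}}} = {u\<in>S. {w, u} \<in> edges H} - {v}"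
    using \<open>w \<notin> S\<close> by (auto simp: doubleton_eq_iff)
  moreover have vin: "v \<in> {u\<in>S. {w, u} \<in> edges H}"
    using K(2) w(1) by (simp add: insert_commute)
  moreover have "card {u\<in>S. {w, u} \<in> edges H} > 0"
    using vin S(1) by (subst card_gt_0_iff) auto
  ultimately have "odd (card {u\<in>S. {w, u} \<in> edges (delete_edge H {v, w})})"
    using ev[OF \<open>w \<notin> S\<close>] by (simp add: card_Diff_singleton)
  moreover have "even (card {u\<in>S. {x, u} \<in> edges (delete_edge H {v, w})})"
    if "x \<notin> S" "x \<noteq> w" for x
  proof -
    have "{u\<in>S. {x, u} \<in> edges (delete_edge H {v, w})} = {u\<in>S. {x, u} \<in> edges H}"
      using that K(2) by (auto simp: doubleton_eq_iff)
    then show ?thesis using ev[OF that(1)] by simp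
  qed
  ultimately obtain u where u: "u \<in> S" "ueg_move q (delete_edge (delete_edge H {v, w}) {w, u}, u)"
    "even_kernel S (delete_edge (delete_edge H {v, w}) {w, u})"
    using ex_move_to_even_kernel[of S "delete_edge H {v, w}" w] S \<open>w \<notin> S\<close> w(2) by auto
  have "edges (delete_edge (delete_edge H {v, w}) {w, u}) \<subseteq> edges H - {{v, w}}" by auto
  then have "edges (delete_edge (delete_edge H {v, w}) {w, u}) \<subset> edges H" using w(1) by blast
  then show ?thesis using u by blast
qed

lemma complete_play_Cons:
  assumes "complete_play q ps" "ueg_move p q"
  shows "complete_play p (p # ps)"
  using assms by (cases ps) (auto simp: complete_play_def)

text \<open>The second player answers every move of \<open>s\<close> by returning to
  \<open>S\<close>, so only the first player can get stuck. Each such round adds two positions to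
  the play.\<close>

lemma even_kernel_losing_play:
  assumes "strategy s" "finite (edges H)" "even_kernel S H" "v \<in> S"
  shows "\<exists>ps. complete_play (H, v) ps \<and> first_player_follows s ps \<and> odd (length ps)"
  using assms(2-)
proof (induction "edges H" arbitrary: H v rule: finite_psubset_induct)
  case psubset
  show ?case
  proof (cases "\<exists>q. ueg_move (H, v) q")
    case False
    then have "complete_play (H, v) [(H, v)]" by (auto simp: complete_play_def)
    then show ?thesis by (intro exI[of _ "[(H, v)]"]) (auto simp: first_player_follows_def)
  next
    case True
    let ?q = "s (H, v)"
    have mv: "ueg_move (H, v) ?q" using assms(1) True by (auto simp: strategy_def)
    obtain H' u where r: "ueg_move ?q (H', u)" "u \<in> S" "even_kernel S H'" "edges H' \<subset> edges H"
      using even_kernel_reply[OF psubset.prems mv] by blast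
    from psubset.hyps(2)[OF r(4) r(3,2)] obtain ps where
      ps: "complete_play (H', u) ps" "first_player_follows s ps" "odd (length ps)"
      by blast
    have "complete_play (H, v) ((H, v) # ?q # ps)"
      using complete_play_Cons[OF complete_play_Cons[OF ps(1) r(1)] mv] .
    moreover have "first_player_follows s ((H, v) # ?q # ps)"
      unfolding first_player_follows_def
    proof (intro allI impI)
      fix i assume i: "even i \<and> Suc i < length ((H, v) # ?q # ps)"
      show "((H, v) # ?q # ps) ! Suc i = s (((H, v) # ?q # ps) ! i)"
      proof (cases i)
        case (Suc j)
        then obtain k where "i = Suc (Suc k)" using i by (cases j) auto
        then show ?thesis using i ps(2) by (auto simp: first_player_follows_def)
      qed simp
    qed
    ultimately show ?thesis using ps(3) by (intro exI[of _ "(H, v) # ?q # ps"]) auto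
  qed
qed

lemma P_position_even_kernel:
  assumes "finite (edges H)" "even_kernel S H" "v \<in> S"
  shows "P_position (H, v)"
  using even_kernel_losing_play[OF _ assms]
  by (auto simp: P_position_def N_position_def winning_strategy_def)

lemma N_position_move_to_even_kernel:
  fixes p :: "'a position"
  assumes "ueg_move p (H, u)" "u \<in> S" "even_kernel S H"
  shows "N_position p"
proof -
  define good where "good q \<longleftrightarrow> snd q \<in> S \<and> even_kernel S (fst q)" for q :: "'a position"
  \<comment> \<open>A good position is chosen whenever one move reaches it; the fallback keeps
    \<open>s\<close> legal elsewhere, as \<open>strategy\<close> demands.\<close>
  define s where "s p = (if \<exists>q. ueg_move p q \<and> good q then SOME q. ueg_move p q \<and> good q
    else SOME q. ueg_move p q)" for p :: "'a position"
  have s_good: "ueg_move p (s p) \<and> good (s p)" if "\<exists>q. ueg_move p q \<and> good q" for p :: "'a position"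
    using someI_ex[OF that] that by (simp add: s_def)
  have "strategy s" unfolding strategy_def
  proof (intro allI impI)
    fix p :: "'a position" assume ex: "\<exists>q. ueg_move p q"
    show "ueg_move p (s p)"
      using s_good[of p] someI_ex[OF ex] by (cases "\<exists>q. ueg_move p q \<and> good q") (auto simp: s_def)
  qed
  \<comment> \<open>Invariant at the first player's turns: a good move exists.
    \<open>even_kernel_reply\<close> restores it after any answer of the opponent.\<close>
  moreover have "even (length ps)"
    if "\<exists>q. ueg_move p q \<and> good q" "complete_play p ps" "first_player_follows s ps"
    for p :: "'a position" and ps
    using that
  proof (induction ps arbitrary: p rule: length_induct)
    case (1 ps)
    then obtain ps1 where ps1: "ps = p # ps1"
      by (cases ps) (auto simp: complete_play_def)
    with 1 have "ps1 \<noteq> []" by (auto simp: complete_play_def)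
    then obtain q ps2 where ps2: "ps1 = q # ps2" by (cases ps1) auto
    have q: "q = s p" using 1(4) by (force simp: first_player_follows_def ps1 ps2)
    have good: "good q" using s_good[OF 1(2)] q by simp
    show ?case
    proof (cases ps2)
      case Nil
      then show ?thesis by (simp add: ps1 ps2)
    next
      case (Cons r ps3)
      have mv: "ueg_move q r" using 1(3) by (auto simp: complete_play_def ps1 ps2 Cons)
      obtain H v where Hv: "q = (H, v)" by (cases q)
      have "\<exists>r'. ueg_move r r' \<and> good r'"
        using even_kernel_reply[of S H v r] good mv by (auto simp: good_def Hv)
      moreover have "complete_play r ps2"
        using 1(3) by (auto simp: complete_play_def ps1 ps2 Cons)
      moreover have "first_player_follows s ps2"
        unfolding first_player_follows_def
      proof (intro allI impI)
        fix i assume "even i \<and> Suc i < length ps2"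
        then show "ps2 ! Suc i = s (ps2 ! i)"
          using 1(4)[unfolded first_player_follows_def, rule_format, of "Suc (Suc i)"]
          by (simp add: ps1 ps2)
      qed
      ultimately have "even (length ps2)"
        using 1(1)[rule_format, of ps2 r] by (simp add: ps1 ps2)
      then show ?thesis by (simp add: ps1 ps2)
    qed
  qed
  moreover have "\<exists>q. ueg_move p q \<and> good q" using assms by (auto simp: good_def)
  ultimately show ?thesis unfolding N_position_def winning_strategy_def by blast
qed

section \<open>Duality over the two-element field\<close>

text \<open>Additivity of the standard bilinear form on subsets, seen as vectors over the
  two-element field with \<open>sym_diff\<close> as addition.\<close>

lemma odd_card_Int_sym_diff:
  assumes "finite Y"
  shows "odd (card (Y \<inter> sym_diff A B)) \<longleftrightarrow> odd (card (Y \<inter> A)) \<noteq> odd (card (Y \<inter> B))"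
  using assms by (induction Y rule: finite_induct) (auto simp: Int_insert_left)

text \<open>Fredholm alternative over the two-element field: \<open>B\<close> lies in the span of
  the \<open>A i\<close>, or some functional \<open>Y\<close> kills every \<open>A i\<close> but not
  \<open>B\<close>. In the induction step, if neither \<open>B\<close> nor \<open>B + A i\<close> is
  in the old span, both have separators, which are then combined.\<close>

lemma span_or_separated:
  assumes "finite I" "finite X" "B \<subseteq> X" "\<And>i. i \<in> I \<Longrightarrow> A i \<subseteq> X"
  shows "(\<exists>T\<subseteq>I. \<forall>x\<in>X. odd (card {t\<in>T. x \<in> A t}) \<longleftrightarrow> x \<in> B) \<or>
    (\<exists>Y\<subseteq>X. (\<forall>i\<in>I. even (card (Y \<inter> A i))) \<and> odd (card (Y \<inter> B)))"
  using assms(1,3,4)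
proof (induction I arbitrary: B rule: finite_induct)
  case empty
  show ?case
  proof (cases "B = {}")
    case False
    then obtain x where "x \<in> B" by blast
    then show ?thesis using empty by (intro disjI2 exI[of _ "{x}"]) auto
  qed auto
next
  case (insert i I)
  let ?sep = "\<lambda>B Y. Y \<subseteq> X \<and> (\<forall>i\<in>I. even (card (Y \<inter> A i))) \<and> odd (card (Y \<inter> B))"
  have sub: "sym_diff B (A i) \<subseteq> X" using insert.prems by blast
  have IH: "(\<exists>T\<subseteq>I. \<forall>x\<in>X. odd (card {t\<in>T. x \<in> A t}) \<longleftrightarrow> x \<in> C) \<or> (\<exists>Y. ?sep C Y)"
    if "C \<subseteq> X" for C
    using insert.IH[OF that insert.prems(2)] by simp
  consider (T1) "\<exists>T\<subseteq>I. \<forall>x\<in>X. odd (card {t\<in>T. x \<in> A t}) \<longleftrightarrow> x \<in> B"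
    | (T2) "\<exists>T\<subseteq>I. \<forall>x\<in>X. odd (card {t\<in>T. x \<in> A t}) \<longleftrightarrow> x \<in> sym_diff B (A i)"
    | (Y) "\<exists>Y. ?sep B Y" "\<exists>Y. ?sep (sym_diff B (A i)) Y"
    using IH[OF insert.prems(1)] IH[OF sub] by argo
  then show ?case
  proof cases
    case T1
    then show ?thesis by (intro disjI1) blast
  next
    case T2
    then obtain T where T: "T \<subseteq> I"
      "\<And>x. x \<in> X \<Longrightarrow> odd (card {t\<in>T. x \<in> A t}) \<longleftrightarrow> x \<in> sym_diff B (A i)" by blast
    have fin: "finite T" "i \<notin> T" using T(1) insert.hyps finite_subset by auto
    have "{t \<in> insert i T. x \<in> A t} =
      (if x \<in> A i then insert i {t\<in>T. x \<in> A t} else {t\<in>T. x \<in> A t})" for x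
      by auto
    then have "odd (card {t \<in> insert i T. x \<in> A t}) \<longleftrightarrow> x \<in> B" if "x \<in> X" for x
      using T(2)[OF that] fin by auto
    then show ?thesis using T(1) by (intro disjI1 exI[of _ "insert i T"]) auto
  next
    case Y
    then obtain Y1 Y2 where Y1: "?sep B Y1" and Y2: "?sep (sym_diff B (A i)) Y2" by blast
    let ?Y3 = "sym_diff Y1 Y2"
    have fin: "finite Y1" "finite Y2" using Y1 Y2 assms(2) finite_subset by auto
    have Y3: "odd (card (?Y3 \<inter> Z)) \<longleftrightarrow> odd (card (Y1 \<inter> Z)) \<noteq> odd (card (Y2 \<inter> Z))"
      if "Z \<subseteq> X" for Z
      using odd_card_Int_sym_diff[of Z Y1 Y2] that assms(2) finite_subset
      by (auto simp: Int_commute)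
    have B2: "odd (card (Y2 \<inter> B)) \<noteq> odd (card (Y2 \<inter> A i))"
      using Y2 odd_card_Int_sym_diff[OF fin(2)] by blast
    have Ai: "A i \<subseteq> X" and AI: "\<And>k. k \<in> I \<Longrightarrow> A k \<subseteq> X" using insert.prems by auto
    \<comment> \<open>One of \<open>Y1\<close>, \<open>Y2\<close> and their sum is even on
      \<open>A i\<close> and odd on \<open>B\<close>.\<close>
    consider "even (card (Y1 \<inter> A i))" | "even (card (Y2 \<inter> A i))"
      | "odd (card (Y1 \<inter> A i))" "odd (card (Y2 \<inter> A i))" by blast
    then have "\<exists>Y\<subseteq>X. (\<forall>k\<in>insert i I. even (card (Y \<inter> A k))) \<and> odd (card (Y \<inter> B))"
    proof cases
      case 1
      then show ?thesis using Y1 by (intro exI[of _ Y1]) auto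
    next
      case 2
      then show ?thesis using Y2 B2 by (intro exI[of _ Y2]) auto
    next
      case 3
      have "?Y3 \<subseteq> X" using Y1 Y2 by blast
      moreover have "\<forall>k\<in>insert i I. even (card (?Y3 \<inter> A k))"
        using 3 Y1 Y2 Y3[OF Ai] Y3[OF AI] by blast
      moreover have "odd (card (?Y3 \<inter> B))"
        using 3 Y1 B2 Y3[OF insert.prems(1)] by blast
      ultimately show ?thesis by blast
    qed
    then show ?thesis by blast
  qed
qed

section \<open>Neighbourhoods in the grid\<close>

definition grid_adj :: "nat \<times> nat \<Rightarrow> nat \<times> nat \<Rightarrow> bool" where
  "grid_adj x y \<longleftrightarrow> \<bar>int (fst x) - int (fst y)\<bar> + \<bar>int (snd x) - int (snd y)\<bar> = 1"

lemma grid_adj_commute: "grid_adj x y \<longleftrightarrow> grid_adj y x"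
  by (auto simp: grid_adj_def)

lemma verts_grid_graph: "verts (grid_graph m n) = {1..m} \<times> {1..n}"
  by (simp add: grid_graph_def)

lemma edge_grid_graph_iff:
  "{x, y} \<in> edges (grid_graph m n) \<longleftrightarrow>
     x \<in> verts (grid_graph m n) \<and> y \<in> verts (grid_graph m n) \<and> grid_adj x y"
proof
  assume "{x, y} \<in> edges (grid_graph m n)"
  then obtain p q where "{x, y} = {p, q}" "p \<in> verts (grid_graph m n)"
    "q \<in> verts (grid_graph m n)" "grid_adj p q"
    by (auto simp: grid_graph_def grid_adj_def)
  then show "x \<in> verts (grid_graph m n) \<and> y \<in> verts (grid_graph m n) \<and> grid_adj x y"
    using grid_adj_commute[of p q] by (auto simp: doubleton_eq_iff)
next
  assume "x \<in> verts (grid_graph m n) \<and> y \<in> verts (grid_graph m n) \<and> grid_adj x y"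
  then show "{x, y} \<in> edges (grid_graph m n)"
    by (cases x; cases y) (force simp: grid_graph_def grid_adj_def)
qed

lemma finite_edges_grid_graph: "finite (edges (grid_graph m n))"
  by (rule finite_subset[of _ "Pow (verts (grid_graph m n))"]) (auto simp: grid_graph_def)

lemma grid_adj_parity:
  assumes "grid_adj x y"
  shows "even (fst x + snd x) \<longleftrightarrow> odd (fst y + snd y)"
proof -
  have "odd (\<bar>int (fst x) - int (fst y)\<bar> + \<bar>int (snd x) - int (snd y)\<bar>)"
    using assms unfolding grid_adj_def by simp
  then show ?thesis by auto
qed

text \<open>With \<open>\<noteq>\<close> on truth values read as addition modulo 2, the right-hand
  side is the discrete wave equation at \<open>(i, j)\<close>. The bounds keep \<open>i - 1\<close>
  and \<open>j - 1\<close> from truncating.\<close>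

lemma even_card_grid_neighbours:
  assumes "i \<ge> 1" "j \<ge> 1"
  shows "even (card {u\<in>S. grid_adj (i, j) u}) \<longleftrightarrow>
    (((i + 1, j) \<in> S) \<noteq> ((i - 1, j) \<in> S)) = (((i, j + 1) \<in> S) \<noteq> ((i, j - 1) \<in> S))"
proof -
  have adj: "grid_adj (i, j) u \<longleftrightarrow> u \<in> {(i + 1, j), (i - 1, j), (i, j + 1), (i, j - 1)}" for u
    using assms by (cases u) (auto simp: grid_adj_def)
  have "{u\<in>S. grid_adj (i, j) u} =
    S \<inter> {(i + 1, j), (i - 1, j), (i, j + 1), (i, j - 1)}" unfolding adj by blast
  then show ?thesis using assms by (simp add: Int_insert_right)
qed

section \<open>An even kernel through \<open>(a, b)\<close>\<close>

text \<open>\<open>f\<close> has d'Alembert form, so it solves the wave equation; symmetry and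
  periodicity of \<open>G\<close> make it vanish on the frame around the grid.\<close>

lemma grid_even_kernel:
  fixes m n a b d :: nat
  assumes d: "d = gcd (m + 1) (n + 1)" and v: "(a, b) \<in> verts (grid_graph m n)"
    and "\<not> d dvd a" "\<not> d dvd b"
  shows "\<exists>S. even_kernel S (grid_graph m n) \<and> (a, b) \<in> S"
proof -
  define c where "c = int a + int b"
  define G where "G t \<longleftrightarrow> 2 * int d dvd t - c \<or> 2 * int d dvd t + c" for t
  define f where "f i j \<longleftrightarrow> G (i + j) \<noteq> G (i - j)" for i j
  define S where "S = {x \<in> verts (grid_graph m n). f (int (fst x)) (int (snd x))}"
  have G_minus: "G (- t) = G t" for t
  proof -
    have "- t - c = - (t + c)" "- t + c = - (t - c)" by simp_all
    then show ?thesis unfolding G_def by (metis dvd_minus_iff)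
  qed
  have G_period: "G (t + 2 * k) = G t" if "int d dvd k" for t k
  proof -
    have "2 * int d dvd 2 * k" using that by simp
    moreover have "t + 2 * k - c = (t - c) + 2 * k" "t + 2 * k + c = (t + c) + 2 * k" by simp_all
    ultimately show ?thesis unfolding G_def by (metis dvd_add_left_iff)
  qed
  have dM: "int d dvd 1 + int m" and dN: "int d dvd 1 + int n"
    unfolding d int_dvd_int_iff of_nat_Suc[symmetric] by simp_all
  have f_left: "\<not> f 0 j" for j using G_minus[of j] by (simp add: f_def)
  have f_bottom: "\<not> f i 0" for i by (simp add: f_def)
  have f_right: "\<not> f (1 + int m) j" for j
    using G_minus[of "j - (1 + int m)"] G_period[OF dM, of "j - (1 + int m)"]
    by (simp add: f_def algebra_simps)
  have f_top: "\<not> f i (1 + int n)" for i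
    using G_period[OF dN, of "i - (1 + int n)"] by (simp add: f_def algebra_simps)
  \<comment> \<open>Including the frame lets the wave equation give the parity at border vertices
    too.\<close>
  have S_iff: "(i, j) \<in> S \<longleftrightarrow> f (int i) (int j)" if "i \<le> m + 1" "j \<le> n + 1" for i j
  proof -
    have "i = 0 \<or> j = 0 \<or> i = m + 1 \<or> j = n + 1 \<or> (i, j) \<in> verts (grid_graph m n)"
      using that by (auto simp: verts_grid_graph)
    then show ?thesis using f_left f_bottom f_right f_top
      by (auto simp: S_def verts_grid_graph)
  qed
  have wave: "(f (i + 1) j \<noteq> f (i - 1) j) = (f i (j + 1) \<noteq> f i (j - 1))" for i j
    by (auto simp: f_def algebra_simps)
  have even: "even (card {u\<in>S. {w, u} \<in> edges (grid_graph m n)})" for w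
  proof (cases "w \<in> verts (grid_graph m n)")
    case True
    obtain i j where w: "w = (i, j)" by (cases w)
    have ij: "1 \<le> i" "i \<le> m" "1 \<le> j" "j \<le> n" using True by (auto simp: w verts_grid_graph)
    have "{u\<in>S. {w, u} \<in> edges (grid_graph m n)} = {u\<in>S. grid_adj (i, j) u}"
      using True by (auto simp: edge_grid_graph_iff S_def w)
    moreover have "(((i + 1, j) \<in> S) \<noteq> ((i - 1, j) \<in> S)) = (((i, j + 1) \<in> S) \<noteq> ((i, j - 1) \<in> S))"
      using wave[of "int i" "int j"] ij by (simp add: S_iff of_nat_diff add.commute)
    ultimately show ?thesis using even_card_grid_neighbours[OF ij(1,3)] by simp
  qed (simp add: edge_grid_graph_iff)
  \<comment> \<open>Since \<open>2 * d\<close> is even, \<open>G\<close> lives on one parity class;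
    hence \<open>S\<close> lies in one colour class of the bipartite grid and is
    independent.\<close>
  have parity: "even (fst x + snd x) \<longleftrightarrow> even c" if "x \<in> S" for x
  proof -
    have "G (int (fst x) + int (snd x)) \<or> G (int (fst x) - int (snd x))"
      using that by (auto simp: S_def f_def)
    moreover have "even t \<longleftrightarrow> even c" if "G t" for t
    proof -
      have "even (t - c) \<or> even (t + c)" using that unfolding G_def by (meson dvd_mult_left)
      then show ?thesis by auto
    qed
    ultimately have "even (int (fst x) + int (snd x)) = even c" by fastforce
    then show ?thesis by simp
  qed
  have "even_kernel S (grid_graph m n)"
    unfolding even_kernel_def
  proof (intro conjI ballI allI impI)
    show "finite S" by (simp add: S_def verts_grid_graph)
    show "{x, y} \<notin> edges (grid_graph m n)" if "x \<in> S" "y \<in> S" for x y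
      using parity[OF that(1)] parity[OF that(2)] grid_adj_parity[of x y]
      by (auto simp: edge_grid_graph_iff)
    show "even (card {u\<in>S. {w, u} \<in> edges (grid_graph m n)})" for w by (rule even)
  qed
  moreover have "(a, b) \<in> S"
  proof -
    \<comment> \<open>Membership of \<open>a - b\<close> in the support of \<open>G\<close> thus
      amounts to \<open>d dvd b\<close> or \<open>d dvd a\<close>.\<close>
    have e: "int a - int b - c = 2 * (- int b)" "int a - int b + c = 2 * int a"
      by (simp_all add: c_def)
    have "\<not> G (int a - int b)"
      unfolding G_def e using assms(3,4) by simp
    moreover have "G (int a + int b)" by (simp add: G_def c_def)
    ultimately show ?thesis using v by (simp add: S_def f_def)
  qed
  ultimately show ?thesis by blast
qed

section \<open>Kernel vectors vanish at \<open>(a, b)\<close>\<close>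

text \<open>For positive \<open>M\<close>, folds the integer line onto \<open>{0..M}\<close> by the
  reflections in the multiples of \<open>M\<close>.\<close>

definition refl_fold :: "nat \<Rightarrow> int \<Rightarrow> nat" where
  "refl_fold M i = (let r = i mod (2 * int M) in nat (if r \<le> int M then r else 2 * int M - r))"

lemma refl_fold_id: "i \<le> M \<Longrightarrow> refl_fold M (int i) = i"
  by (cases "M = 0") (auto simp: refl_fold_def Let_def)

lemma refl_fold_mult: "refl_fold M (k * int M) \<in> {0, M}"
proof -
  have "k * int M mod (2 * int M) = (k mod 2) * int M"
    by (metis mult_mod_left)
  moreover have "k mod 2 = 0 \<or> k mod 2 = 1" by auto
  ultimately show ?thesis by (auto simp: refl_fold_def Let_def)
qed

text \<open>At a mirror both neighbours fold together; elsewhere neighbours fold to neighbours,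
  possibly swapped. This carries the wave equation over to reflected extensions.\<close>

lemma refl_fold_step:
  assumes "M \<ge> 2"
  shows "refl_fold M i \<in> {0, M} \<and> refl_fold M (i + 1) = refl_fold M (i - 1) \<or>
    1 \<le> refl_fold M i \<and> refl_fold M i < M \<and>
      (refl_fold M (i + 1) = refl_fold M i + 1 \<and> refl_fold M (i - 1) = refl_fold M i - 1 \<or>
       refl_fold M (i + 1) = refl_fold M i - 1 \<and> refl_fold M (i - 1) = refl_fold M i + 1)"
proof -
  define L where "L = 2 * int M"
  define r where "r = i mod L"
  have L: "L \<ge> 4" using assms by (simp add: L_def)
  have r: "0 \<le> r" "r < L" using L by (auto simp: r_def)
  have "(i + 1) mod L = (r + 1) mod L" "(i - 1) mod L = (r - 1) mod L"
    by (simp_all add: r_def mod_simps)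
  moreover have "(r + 1) mod L = (if r + 1 = L then 0 else r + 1)" using r L by auto
  moreover have "(r - 1) mod L = (if r = 0 then L - 1 else r - 1)"
  proof (cases "r = 0")
    case True
    then show ?thesis using L by (simp add: zmod_minus1)
  qed (use r in auto)
  ultimately have *: "(i + 1) mod L = (if r + 1 = L then 0 else r + 1)"
    "(i - 1) mod L = (if r = 0 then L - 1 else r - 1)" by simp_all
  consider "r = 0" | "0 < r" "r < int M" | "r = int M" | "int M < r" "r + 1 < L" | "r + 1 = L"
    using r by linarith
  then show ?thesis
    unfolding refl_fold_def Let_def L_def[symmetric] * r_def[symmetric]
    by cases (use assms in \<open>auto simp: L_def\<close>)
qed

text \<open>The wave equation is the case \<open>p = q = 1\<close>. Unit squares add up to a strip
  (\<open>one\<close>), strips to the rectangle, with shared corners cancelling.\<close>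

lemma wave_rectangle:
  fixes f :: "int \<Rightarrow> int \<Rightarrow> bool"
  assumes wave: "\<And>i j. (f (i + 1) j \<noteq> f (i - 1) j) = (f i (j + 1) \<noteq> f i (j - 1))"
  shows "(f i j \<noteq> f (i + int p) (j + int p)) =
    (f (i + int q) (j - int q) \<noteq> f (i + int p + int q) (j + int p - int q))"
proof -
  have one: "(f i j \<noteq> f (i + 1) (j - 1)) =
    (f (i + int p) (j + int p) \<noteq> f (i + int p + 1) (j + int p - 1))" for i j p
  proof (induction p)
    case (Suc p)
    then show ?case using wave[of "i + int p + 1" "j + int p"] by (auto simp: algebra_simps)
  qed simp
  show ?thesis
  proof (induction q)
    case (Suc q)
    then show ?case using one[of "i + int q" "j - int q" p] by (auto simp: algebra_simps)
  qed simp
qed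

text \<open>
  The point \<open>(x, y)\<close>, its transpose and the points \<open>(x - y, 0)\<close>, \<open>(0, x - y)\<close> on the axes are
  the corners of a rectangle with diagonal sides; over such a rectangle a solution of the
  wave equation sums to \<open>0\<close>.
\<close>

lemma wave_transpose:
  fixes f :: "int \<Rightarrow> int \<Rightarrow> bool"
  assumes wave: "\<And>i j. (f (i + 1) j \<noteq> f (i - 1) j) = (f i (j + 1) \<noteq> f i (j - 1))"
    and zero: "\<And>i. \<not> f i y0" "\<And>j. \<not> f x0 j"
  shows "f (x0 + x) (y0 + y) = f (x0 + y) (y0 + x)"
proof -
  \<comment> \<open>The sign of \<open>y\<close> decides which corner is leftmost: the point on the
    line \<open>x0\<close> or the transposed point.\<close>
  have *: "f (x0 + x) (y0 + y) = f (x0 + y) (y0 + x)" if "x \<ge> y" for x y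
  proof (cases "y \<ge> 0")
    case True
    show ?thesis
      using wave_rectangle[of f x0 "y0 + (x - y)" "nat y" "nat (x - y)"] wave zero that True
      by (auto simp: algebra_simps)
  next
    case False
    show ?thesis
      using wave_rectangle[of f "x0 + y" "y0 + x" "nat (- y)" "nat (x - y)"] wave zero that False
      by (auto simp: algebra_simps)
  qed
  show ?thesis using *[of x y] *[of y x] by (cases "x \<ge> y") auto
qed

lemma grid_kernel_vanishes:
  fixes m n a b d :: nat
  assumes mn: "m \<ge> 1" "n \<ge> 1" and d: "d = gcd (m + 1) (n + 1)"
    and v: "(a, b) \<in> verts (grid_graph m n)"
    and dvd: "d dvd a \<or> d dvd b" and Y: "Y \<subseteq> verts (grid_graph m n)"
    and even: "\<And>x. x \<in> verts (grid_graph m n) \<Longrightarrow> even (card {u\<in>Y. grid_adj x u})"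
  shows "(a, b) \<notin> Y"
proof -
  define M where "M = m + 1"
  define N where "N = n + 1"
  define f where "f i j \<longleftrightarrow> (refl_fold M i, refl_fold N j) \<in> Y" for i j
  have boundary: "(i, j) \<notin> Y" if "i \<in> {0, M} \<or> j \<in> {0, N}" for i j
    using that Y by (auto simp: verts_grid_graph M_def N_def)
  have wave: "(f (i + 1) j \<noteq> f (i - 1) j) = (f i (j + 1) \<noteq> f i (j - 1))" for i j
  proof -
    have M: "M \<ge> 2" "N \<ge> 2" using mn by (auto simp: M_def N_def)
    define k where "k = refl_fold M i"
    define l where "l = refl_fold N j"
    note sM = refl_fold_step[OF M(1), of i, folded k_def]
    note sN = refl_fold_step[OF M(2), of j, folded l_def]
    \<comment> \<open>On a mirror, two neighbours of the point stay on it, where \<open>f\<close>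
      vanishes, and the two across it fold together. Off the mirrors the parity condition on
      \<open>Y\<close> applies.\<close>
    show ?thesis
    proof (cases "k \<in> {0, M}"; cases "l \<in> {0, N}")
      assume k: "k \<in> {0, M}"
      then have "refl_fold M (i + 1) = refl_fold M (i - 1)" using sM by auto
      then show ?thesis using k by (simp add: f_def boundary flip: k_def)
    next
      assume k: "k \<in> {0, M}"
      then have "refl_fold M (i + 1) = refl_fold M (i - 1)" using sM by auto
      then show ?thesis using k by (simp add: f_def boundary flip: k_def)
    next
      assume l: "l \<in> {0, N}"
      then have "refl_fold N (j + 1) = refl_fold N (j - 1)" using sN by auto
      then show ?thesis using l by (simp add: f_def boundary flip: l_def)
    next
      assume F: "k \<notin> {0, M}" "l \<notin> {0, N}"
      then have kl: "(k, l) \<in> verts (grid_graph m n)" "k \<ge> 1" "l \<ge> 1"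
        using sM sN by (auto simp: verts_grid_graph M_def N_def)
      from F(1) sM have k: "refl_fold M (i + 1) = k + 1 \<and> refl_fold M (i - 1) = k - 1 \<or>
        refl_fold M (i + 1) = k - 1 \<and> refl_fold M (i - 1) = k + 1" by blast
      from F(2) sN have l: "refl_fold N (j + 1) = l + 1 \<and> refl_fold N (j - 1) = l - 1 \<or>
        refl_fold N (j + 1) = l - 1 \<and> refl_fold N (j - 1) = l + 1" by blast
      have "(((k + 1, l) \<in> Y) \<noteq> ((k - 1, l) \<in> Y)) = (((k, l + 1) \<in> Y) \<noteq> ((k, l - 1) \<in> Y))"
        using even[OF kl(1)] even_card_grid_neighbours[OF kl(2,3), of Y] by simp
      then show ?thesis
        unfolding f_def k_def[symmetric] l_def[symmetric] using k l by (elim disjE) auto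
    qed
  qed
  have zM: "\<not> f (k * int M) j" and zN: "\<not> f i (k * int N)" for i j k
    using boundary refl_fold_mult[of M k] refl_fold_mult[of N k] by (auto simp: f_def)
  have bezout: "\<exists>k l. int c = k * int M + l * int N" if dc: "d dvd c" for c
  proof -
    obtain u w where "u * int M + w * int N = gcd (int M) (int N)" using bezout_int by blast
    then have uw: "u * int M + w * int N = int d" by (simp add: d M_def N_def gcd_int_int_eq del: of_nat_Suc of_nat_add)
    obtain e where "c = d * e" using dc by blast
    then have "int c = (u * int e) * int M + (w * int e) * int N"
      by (simp add: uw[symmetric] algebra_simps)
    then show ?thesis by blast
  qed
  have "\<not> f (int a) (int b)"
    using dvd
  proof
    assume "d dvd a"
    then obtain k l where kl: "int a = k * int M + l * int N" using bezout by blast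
    \<comment> \<open>Transposition about \<open>(k * M, - l * N)\<close> sends
      \<open>(a, b)\<close> to second coordinate 0.\<close>
    show ?thesis
      using wave_transpose[of f "(- l) * int N" "k * int M" "l * int N" "int b + l * int N"]
        wave zM zN zN[of _ 0] zN[of _ "- l"] kl by (simp add: algebra_simps)
  next
    assume "d dvd b"
    then obtain k l where kl: "int b = k * int M + l * int N" using bezout by blast
    \<comment> \<open>Transposition about \<open>(- k * M, l * N)\<close> sends
      \<open>(a, b)\<close> to first coordinate 0.\<close>
    show ?thesis
      using wave_transpose[of f "l * int N" "(- k) * int M" "int a + k * int M" "k * int M"]
        wave zM zN zM[of 0] zM[of "- k"] kl by (simp add: algebra_simps)
  qed
  moreover have "refl_fold M (int a) = a" "refl_fold N (int b) = b"
    using v by (auto simp: verts_grid_graph M_def N_def intro!: refl_fold_id)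
  ultimately show ?thesis by (simp add: f_def)
qed

section \<open>The winning first move\<close>

lemma N_position_grid:
  fixes m n a b d :: nat
  assumes "m \<ge> 1" "n \<ge> 1" "d = gcd (m + 1) (n + 1)"
    and v: "(a, b) \<in> verts (grid_graph m n)" and "d dvd a \<or> d dvd b"
  shows "N_position (grid_graph m n, (a, b))"
proof -
  let ?H = "grid_graph m n"
  let ?V = "verts (grid_graph m n)"
  have fin: "finite ?V" by (simp add: verts_grid_graph)
  \<comment> \<open>A separating \<open>Y\<close> would be a kernel vector containing
    \<open>(a, b)\<close>.\<close>
  have "\<not> (\<exists>Y\<subseteq>?V. (\<forall>x\<in>?V. even (card (Y \<inter> {u\<in>?V. grid_adj x u}))) \<and> odd (card (Y \<inter> {(a, b)})))"
  proof
    assume "\<exists>Y\<subseteq>?V. (\<forall>x\<in>?V. even (card (Y \<inter> {u\<in>?V. grid_adj x u}))) \<and> odd (card (Y \<inter> {(a, b)}))"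
    then obtain Y where Y: "Y \<subseteq> ?V" "\<forall>x\<in>?V. even (card (Y \<inter> {u\<in>?V. grid_adj x u}))"
      "odd (card (Y \<inter> {(a, b)}))" by blast
    have "Y \<inter> {u\<in>?V. grid_adj x u} = {u\<in>Y. grid_adj x u}" for x using Y(1) by blast
    then have "(a, b) \<notin> Y" using grid_kernel_vanishes[OF assms Y(1)] Y(2) by auto
    then show False using Y(3) by simp
  qed
  then obtain T where T: "T \<subseteq> ?V"
    "\<forall>x\<in>?V. odd (card {t\<in>T. x \<in> {u\<in>?V. grid_adj t u}}) \<longleftrightarrow> x \<in> {(a, b)}"
    using span_or_separated[OF fin fin, of "{(a, b)}" "\<lambda>t. {u\<in>?V. grid_adj t u}"] v by blast
  \<comment> \<open>\<open>T\<close> need not be independent. Keeping only the colour opposite to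
    \<open>(a, b)\<close> makes it so, preserves the counts at vertices coloured like
    \<open>(a, b)\<close> and makes all other counts 0.\<close>
  define ev where "ev x \<longleftrightarrow> even (fst x + snd x + (a + b))" for x
  define T' where "T' = {t\<in>T. \<not> ev t}"
  have ev_adj: "ev w \<longleftrightarrow> \<not> ev u" if "grid_adj w u" for w u
    using grid_adj_parity[OF that] by (auto simp: ev_def)
  have nbrs: "{u\<in>T'. {w, u} \<in> edges ?H} =
    (if w \<in> ?V \<and> ev w then {t\<in>T. w \<in> {u\<in>?V. grid_adj t u}} else {})" for w
  proof (rule set_eqI)
    show "u \<in> {u\<in>T'. {w, u} \<in> edges ?H} \<longleftrightarrow>
      u \<in> (if w \<in> ?V \<and> ev w then {t\<in>T. w \<in> {u\<in>?V. grid_adj t u}} else {})" for u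
      using T(1) grid_adj_commute[of w u] ev_adj[of w u] by (auto simp: T'_def edge_grid_graph_iff)
  qed
  have "\<exists>u\<in>T'. ueg_move (?H, (a, b)) (delete_edge ?H {(a, b), u}, u) \<and>
    even_kernel T' (delete_edge ?H {(a, b), u})"
  proof (rule ex_move_to_even_kernel)
    show "finite T'" using T(1) by (intro finite_subset[OF _ fin]) (auto simp: T'_def)
    show "\<forall>x\<in>T'. \<forall>y\<in>T'. {x, y} \<notin> edges ?H"
      using ev_adj by (auto simp: T'_def edge_grid_graph_iff)
    have "ev (a, b)" by (simp add: ev_def)
    then show "(a, b) \<notin> T'" by (simp add: T'_def)
    show "odd (card {u\<in>T'. {(a, b), u} \<in> edges ?H})"
      using T(2) v \<open>ev (a, b)\<close> by (simp only: nbrs) simp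
    show "even (card {u\<in>T'. {w, u} \<in> edges ?H})" if "w \<noteq> (a, b)" for w
      using bspec[OF T(2), of w] that unfolding nbrs by (simp split: if_split)
  qed
  then show ?thesis by (elim bexE conjE) (rule N_position_move_to_even_kernel)
qed

theorem theorem1p2:
  fixes m n a b d :: nat
  assumes "m \<ge> 1" and "n \<ge> 1"
    and "d = gcd (m + 1) (n + 1)"
    and "(a, b) \<in> verts (grid_graph m n)"
  shows "P_position (grid_graph m n, (a, b)) \<longleftrightarrow> \<not> d dvd a \<and> \<not> d dvd b"
proof
  assume "P_position (grid_graph m n, (a, b))"
  then show "\<not> d dvd a \<and> \<not> d dvd b"
    using N_position_grid[OF assms] by (auto simp: P_position_def)
next
  assume "\<not> d dvd a \<and> \<not> d dvd b"
  then show "P_position (grid_graph m n, (a, b))"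
    using grid_even_kernel[OF assms(3,4)] P_position_even_kernel[OF finite_edges_grid_graph]
    by blast
qed

end
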